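(* Let $\mathcal{D}=(G,A)$ be a deductive system, let $s=\frac{p_1,\ldots,p_n}{p_0}$ be a statement, and consider the proof variant tree (PVT) of $s$ together with its sets of substitution proof trees (SPT). For any substitution proof tree $T$ whose root is $(\theta,e)$, with $e$ an expression node of the PVT, the proof tree $\pi(T)$ is a proof of $\theta(e)$, i.e. $\pi(T)$ is a proof in $\mathcal{D}$ whose root is labeled with the expression $\theta(e)$.
   Context: **Deductive systems.** $G$ is a context-free unambiguous grammar with language of expressions $L(G)$ and set of non-terminals $N$. For $n\in N$, $G_n$ is $G$ with start symbol changed to $n$, and $e:n$ means that the expression $e$ belongs to the language of $G_n$. For each $n\in N$ there are infinitely many terminal symbols $v$ with a rule $n\rightarrow v$ in $G$; these are the variables of type $n$. An assertion (or statement) is $a=\frac{p_1,\ldots,p_n}{p_0}$, where the expressions $p_1,\ldots,p_n$ are its premises and the expression $p_0$ is its proposition. A deductive system is a pair $\mathcal{D}=(G,A)$ with $A$ a set of (axiomatic) assertions. **Substitutions.** A substitution $\theta$ maps variables $v:n$ to expressions $e:m$ such that $n\rightarrow m$ is derivable in $G$ (a variable not explicitly mapped is fixed). $\theta(e)$ denotes application to an expression. Application to complex objects (assertions, trees) is component-wise; applied to a substitution $\eta$ occurring in a label it gives $\theta\circ\eta$, where $(\theta\circ\eta)(e)=\theta(\eta(e))$, and the assertion in a label is left unchanged. All applications are assumed type-correct. An expression $e_1$ unifies with $e_2$ (a non-symmetric relation) iff $e_2=\theta(e_1)$ for some substitution $\theta$, called the unifier. **Proof trees and proofs.** A proof tree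 in $\mathcal{D}$ is a tree whose nodes of even depth (e-nodes; the root has depth 0) are labeled with expressions from $L(G)$ and whose nodes of odd depth (a-nodes) are labeled with pairs $(a,\theta)$, $a\in A$, $\theta$ a substitution; each e-node has at most one child, and all leaves are e-nodes. A proof tree is a proof iff for any transition from e-nodes $e_1,\ldots,e_m$ via an a-node $(a,\theta)$ to the e-node $e_0$ (its parent) one has $\frac{e_1,\ldots,e_m}{e_0}=\theta(a)$. **Proof variant tree (PVT) of $s=\frac{p_1,\ldots,p_n}{p_0}$.** Nodes of even depth (e-nodes) are marked with expressions and nodes of odd depth (a-nodes) with assertions. Variables in e-nodes are flagged replaceable or non-replaceable: the variables coming from $s$ are non-replaceable (throughout the tree), the others are replaceable. The root is $p_0$. An e-node $e$ has as children a-nodes marked with all assertions $a=\frac{q_1,\ldots,q_m}{q_0}\in A$ whose proposition unifies with $e$, i.e. $e=\eta(q_0)$ for a substitution $\eta$; the free variables of $a$ are first replaced with fresh ones (variables of $a$ not occurring in $q_0$ thus become fresh replaceable variables). The children of this a-node are the e-nodes $\eta(q_1),\ldots,\eta(q_m)$. The tree is built step by step starting from the root, at each step using all possible variants of expansion. **Unification of substitutions.** A substitution $\delta$ is a unifier of $\Xi=\{\theta_1,\ldots,\theta_m\}$ iff $\delta\circ\theta_i=\delta\circ\theta_j$ for all $i,j$. It is most general, $\delta=\mathrm{mgu}(\Xi)$, iff every unifier $\eta$ of $\Xi$ has the form $\eta=\eta'\circ\delta$; it is unique up to renaming of variables if it exists. $\mathrm{com}(\Xi)$ denotes the common substitution $\mathrm{mgu}(\Xi)\circ\theta_i$.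 **Substitution proof trees (SPT).** An SPT is a tree whose nodes are labeled with a PVT node and a substitution; $\theta(T)$ denotes the substitution at the root of $T$. Every PVT node $x$ has a set $s(x)$ of SPTs, generated as follows (non-replaceable variables are never substituted). (1) For an e-node $e$: if for some premise $p_i$ of $s$ there is a substitution $\theta$ moving only replaceable variables of $e$ with $\theta(e)=p_i$, then the one-node tree $(\theta,e)$ is in $s(e)$. (2) For an a-node $a$ with children $e_1,\ldots,e_m$: for every tuple $T_1\in s(e_1),\ldots,T_m\in s(e_m)$ such that $\delta=\mathrm{mgu}(\theta(T_1),\ldots,\theta(T_m))$ exists, the tree with root $(\theta,a)$, $\theta=\mathrm{com}(\theta(T_1),\ldots,\theta(T_m))$, and immediate subtrees $\delta(T_1),\ldots,\delta(T_m)$ is in $s(a)$; here $\delta$ is applied throughout $T_i$, so each substitution $\sigma$ in a label of $T_i$ becomes $\delta\circ\sigma$. (3) For an e-node $e$, a child $a$ of $e$ and $T_1\in s(a)$: the tree with root $(\theta(T_1),e)$ and the single immediate subtree $T_1$ is in $s(e)$. **The proof tree $\pi(T)$.** For an SPT $T$ rooted at an e-node, $\pi(T)$ is the proof tree of the same shape as $T$, in which an e-node of $T$ labeled $(\theta,e)$ is labeled with the expression $\theta(e)$, and an a-node of $T$ labeled $(\theta,a)$ is labeled with the assertion of $a$ together with $\theta\circ\eta$, where $\eta$ is the unifier with which $a$ was attached to its parent in the PVT. *)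

theory Defs
  imports Main
begin

section \<open>Grammars\<close>

datatype ('n, 't) symbol = NT 'n | TM 't

text \<open>The non-terminals are the elements of the type \<open>'n\<close>, the terminals those of \<open>'t\<close>.
  \<open>vtype G v = Some n\<close> says that the terminal \<open>v\<close> is a variable of type \<open>n\<close>; the
  terminals with \<open>vtype G c = None\<close> are the constant symbols.\<close>

record ('n, 't) grammar =
  rules :: "('n \<times> ('n, 't) symbol list) set"
  start :: 'n
  vtype :: "'t \<Rightarrow> 'n option"

type_synonym 't expr = "'t list"

definition step :: "('n, 't) grammar \<Rightarrow> ('n, 't) symbol list \<Rightarrow> ('n, 't) symbol list \<Rightarrow> bool" where
  "step G u w \<longleftrightarrow> (\<exists>l n r \<alpha>. u = l @ [NT n] @ r \<and> w = l @ \<alpha> @ r \<and> (n, \<alpha>) \<in> rules G)"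

definition derives :: "('n, 't) grammar \<Rightarrow> ('n, 't) symbol list \<Rightarrow> ('n, 't) symbol list \<Rightarrow> bool" where
  "derives G = (step G)\<^sup>*\<^sup>*"

definition lang :: "('n, 't) grammar \<Rightarrow> 't expr set" where
  "lang G = {w. derives G [NT (start G)] (map TM w)}"

definition has_type :: "('n, 't) grammar \<Rightarrow> 't expr \<Rightarrow> 'n \<Rightarrow> bool" where
  "has_type G e n \<longleftrightarrow> e \<in> lang (G\<lparr>start := n\<rparr>)"

datatype ('n, 't) parse_tree = Leaf 't | Branch 'n "('n, 't) parse_tree list"

fun root_symbol :: "('n, 't) parse_tree \<Rightarrow> ('n, 't) symbol" where
  "root_symbol (Leaf t) = TM t"
| "root_symbol (Branch n ts) = NT n"

fun yield_of :: "('n, 't) parse_tree \<Rightarrow> 't expr" where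
  "yield_of (Leaf t) = [t]"
| "yield_of (Branch n ts) = concat (map yield_of ts)"

fun is_parse_tree :: "('n, 't) grammar \<Rightarrow> ('n, 't) parse_tree \<Rightarrow> bool" where
  "is_parse_tree G (Leaf t) \<longleftrightarrow> True"
| "is_parse_tree G (Branch n ts) \<longleftrightarrow>
     (n, map root_symbol ts) \<in> rules G \<and> (\<forall>t\<in>set ts. is_parse_tree G t)"

definition unambiguous :: "('n, 't) grammar \<Rightarrow> bool" where
  "unambiguous G \<longleftrightarrow>
     (\<forall>t u. is_parse_tree G t \<and> root_symbol t = NT (start G) \<and>
            is_parse_tree G u \<and> root_symbol u = NT (start G) \<and> yield_of t = yield_of u \<longrightarrow> t = u)"

text \<open>The last condition makes substitution into strings type-correct: a variable has one
  type, and it enters an expression only through the rule producing it from that type.\<close>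

definition wf_grammar :: "('n, 't) grammar \<Rightarrow> bool" where
  "wf_grammar G \<longleftrightarrow>
     unambiguous G \<and>
     (\<forall>n. infinite {v. vtype G v = Some n}) \<and>
     (\<forall>v n. vtype G v = Some n \<longrightarrow> (n, [TM v]) \<in> rules G) \<and>
     (\<forall>n \<alpha> v. (n, \<alpha>) \<in> rules G \<and> TM v \<in> set \<alpha> \<and> vtype G v \<noteq> None \<longrightarrow>
              \<alpha> = [TM v] \<and> vtype G v = Some n)"

definition vars :: "('n, 't) grammar \<Rightarrow> 't expr \<Rightarrow> 't set" where
  "vars G e = {v \<in> set e. vtype G v \<noteq> None}"


section \<open>Assertions, deductive systems and substitutions\<close>

datatype 't assertion = Assertion (premises_of: "'t expr list") (proposition_of: "'t expr")

definition wf_assertion :: "('n, 't) grammar \<Rightarrow> 't assertion \<Rightarrow> bool" where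
  "wf_assertion G a \<longleftrightarrow> set (premises_of a) \<subseteq> lang G \<and> proposition_of a \<in> lang G"

definition deductive_system :: "('n, 't) grammar \<Rightarrow> 't assertion set \<Rightarrow> bool" where
  "deductive_system G A \<longleftrightarrow> wf_grammar G \<and> (\<forall>a\<in>A. wf_assertion G a)"

definition avars :: "('n, 't) grammar \<Rightarrow> 't assertion \<Rightarrow> 't set" where
  "avars G a = vars G (proposition_of a) \<union> (\<Union>p\<in>set (premises_of a). vars G p)"

text \<open>A substitution is a total function on terminals that fixes every constant symbol and
  every variable not explicitly mapped.\<close>

type_synonym 't subst = "'t \<Rightarrow> 't expr"

definition is_subst :: "('n, 't) grammar \<Rightarrow> 't subst \<Rightarrow> bool" where
  "is_subst G \<theta> \<longleftrightarrow>
     (\<forall>c. vtype G c = None \<longrightarrow> \<theta> c = [c]) \<and>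
     (\<forall>v n. vtype G v = Some n \<longrightarrow> (\<exists>m. derives G [NT n] [NT m] \<and> has_type G (\<theta> v) m))"

definition app :: "'t subst \<Rightarrow> 't expr \<Rightarrow> 't expr" where
  "app \<theta> e = concat (map \<theta> e)"

definition app_assertion :: "'t subst \<Rightarrow> 't assertion \<Rightarrow> 't assertion" where
  "app_assertion \<theta> a = Assertion (map (app \<theta>) (premises_of a)) (app \<theta> (proposition_of a))"

definition subst_comp :: "'t subst \<Rightarrow> 't subst \<Rightarrow> 't subst" (infixl "\<circ>\<^sub>s" 55) where
  "\<theta> \<circ>\<^sub>s \<eta> = (\<lambda>v. app \<theta> (\<eta> v))"

definition moved :: "'t subst \<Rightarrow> 't set" where
  "moved \<theta> = {v. \<theta> v \<noteq> [v]}"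

definition unifies :: "('n, 't) grammar \<Rightarrow> 't expr \<Rightarrow> 't expr \<Rightarrow> bool" where
  "unifies G e\<^sub>1 e\<^sub>2 \<longleftrightarrow> (\<exists>\<theta>. is_subst G \<theta> \<and> e\<^sub>2 = app \<theta> e\<^sub>1)"

text \<open>Unifiers of sets of substitutions; \<open>F\<close> is the set of non-replaceable variables, which
  unifiers must not move.\<close>

definition is_unifier :: "('n, 't) grammar \<Rightarrow> 't set \<Rightarrow> 't subst set \<Rightarrow> 't subst \<Rightarrow> bool" where
  "is_unifier G F \<Xi> \<delta> \<longleftrightarrow>
     is_subst G \<delta> \<and> moved \<delta> \<inter> F = {} \<and> (\<forall>\<theta>\<in>\<Xi>. \<forall>\<theta>'\<in>\<Xi>. \<delta> \<circ>\<^sub>s \<theta> = \<delta> \<circ>\<^sub>s \<theta>')"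

definition is_mgu :: "('n, 't) grammar \<Rightarrow> 't set \<Rightarrow> 't subst set \<Rightarrow> 't subst \<Rightarrow> bool" where
  "is_mgu G F \<Xi> \<delta> \<longleftrightarrow>
     is_unifier G F \<Xi> \<delta> \<and>
     (\<forall>\<eta>. is_unifier G F \<Xi> \<eta> \<longrightarrow> (\<exists>\<eta>'. is_subst G \<eta>' \<and> \<eta> = \<eta>' \<circ>\<^sub>s \<delta>))"

text \<open>The common substitution, for \<open>\<delta>\<close> an mgu of the listed substitutions. By convention,
  for the empty family (premise-free assertions) it is the mgu itself, i.e. the identity up to
  renaming.\<close>

fun com :: "'t subst \<Rightarrow> 't subst list \<Rightarrow> 't subst" where
  "com \<delta> [] = \<delta>"
| "com \<delta> (\<theta> # \<theta>s) = \<delta> \<circ>\<^sub>s \<theta>"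


section \<open>Proof trees and proofs\<close>

text \<open>Trees with e-nodes at even and a-nodes at odd depth, where an e-node has at most one
  child.\<close>

datatype ('e, 'a) etree = ENode (elabel: 'e) "('e, 'a) atree option"
     and ('e, 'a) atree = ANode (alabel: 'a) "('e, 'a) etree list"

type_synonym 't proof_tree = "('t expr, 't assertion \<times> 't subst) etree"

text \<open>All leaves are e-nodes, except that an a-node carrying a premise-free assertion has no
  children.\<close>

fun is_proof_tree :: "('n, 't) grammar \<Rightarrow> 't assertion set \<Rightarrow> 't proof_tree \<Rightarrow> bool" where
  "is_proof_tree G A (ENode e None) \<longleftrightarrow> e \<in> lang G"
| "is_proof_tree G A (ENode e (Some (ANode (a, \<theta>) ts))) \<longleftrightarrow>
     e \<in> lang G \<and> a \<in> A \<and> is_subst G \<theta> \<and> (ts = [] \<longrightarrow> premises_of a = []) \<and>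
     (\<forall>t\<in>set ts. is_proof_tree G A t)"

text \<open>The triples (label of the parent e-node, label of the a-node, labels of its children).\<close>

fun transitions :: "('e, 'a) etree \<Rightarrow> ('e \<times> 'a \<times> 'e list) set" where
  "transitions (ENode e None) = {}"
| "transitions (ENode e (Some (ANode l ts))) =
     insert (e, l, map elabel ts) (\<Union>t\<in>set ts. transitions t)"

definition is_proof :: "('n, 't) grammar \<Rightarrow> 't assertion set \<Rightarrow> 't proof_tree \<Rightarrow> bool" where
  "is_proof G A t \<longleftrightarrow>
     is_proof_tree G A t \<and>
     (\<forall>(e\<^sub>0, (a, \<theta>), es) \<in> transitions t. Assertion es e\<^sub>0 = app_assertion \<theta> a)"


section \<open>Proof variant trees\<close>

text \<open>An e-node of the PVT is addressed by the path leading to it from the root, recording at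
  each level the chosen assertion and the index of the chosen premise; the a-node for the
  assertion \<open>a\<close> below the e-node \<open>x\<close> is \<open>(x, a)\<close>. This addressing is faithful because an e-node
  has one child for each assertion of \<open>A\<close> that applies.\<close>

type_synonym 't enode = "('t assertion \<times> nat) list"
type_synonym 't anode = "'t enode \<times> 't assertion"

text \<open>\<open>ren\<close> is the replacement of the variables of the assertion by fresh ones at an a-node and
  \<open>unif\<close> the unifier of the proposition so renamed with the parent expression.\<close>

record 't pvt =
  expr_of :: "'t enode \<Rightarrow> 't expr"
  ren :: "'t anode \<Rightarrow> 't \<Rightarrow> 't"
  unif :: "'t anode \<Rightarrow> 't subst"

inductive_set enodes :: "('n, 't) grammar \<Rightarrow> 't assertion set \<Rightarrow> 't pvt \<Rightarrow> 't enode set"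
  for G A P where
  "[] \<in> enodes G A P"
| "\<lbrakk>x \<in> enodes G A P; a \<in> A; unifies G (proposition_of a) (expr_of P x);
    i < length (premises_of a)\<rbrakk>
     \<Longrightarrow> x @ [(a, i)] \<in> enodes G A P"

definition anodes :: "('n, 't) grammar \<Rightarrow> 't assertion set \<Rightarrow> 't pvt \<Rightarrow> 't anode set" where
  "anodes G A P =
     {(x, a). x \<in> enodes G A P \<and> a \<in> A \<and> unifies G (proposition_of a) (expr_of P x)}"

definition is_renaming :: "('n, 't) grammar \<Rightarrow> 't set \<Rightarrow> ('t \<Rightarrow> 't) \<Rightarrow> bool" where
  "is_renaming G V \<rho> \<longleftrightarrow>
     inj_on \<rho> V \<and> (\<forall>v\<in>V. vtype G (\<rho> v) = vtype G v) \<and> (\<forall>v. v \<notin> V \<longrightarrow> \<rho> v = v)"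

definition subst_of_ren :: "('t \<Rightarrow> 't) \<Rightarrow> 't subst" where
  "subst_of_ren \<rho> = (\<lambda>v. [\<rho> v])"

definition renamed :: "'t pvt \<Rightarrow> 't anode \<Rightarrow> 't assertion" where
  "renamed P y = app_assertion (subst_of_ren (ren P y)) (snd y)"

definition is_pvt ::
    "('n, 't) grammar \<Rightarrow> 't assertion set \<Rightarrow> 't assertion \<Rightarrow> 't pvt \<Rightarrow> bool" where
  "is_pvt G A s P \<longleftrightarrow>
     expr_of P [] = proposition_of s \<and>
     (\<forall>(x, a) \<in> anodes G A P.
        is_renaming G (avars G a) (ren P (x, a)) \<and>
        avars G (renamed P (x, a)) \<inter> avars G s = {} \<and>
        (\<forall>y \<in> anodes G A P. y \<noteq> (x, a) \<longrightarrow>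
           avars G (renamed P (x, a)) \<inter> avars G (renamed P y) = {}) \<and>
        is_subst G (unif P (x, a)) \<and>
        moved (unif P (x, a)) \<subseteq> vars G (proposition_of (renamed P (x, a))) \<and>
        expr_of P x = app (unif P (x, a)) (proposition_of (renamed P (x, a))) \<and>
        (\<forall>i < length (premises_of a).
           expr_of P (x @ [(a, i)]) = app (unif P (x, a)) (premises_of (renamed P (x, a)) ! i)))"

text \<open>The unifier with which the original, not yet renamed, assertion of \<open>A\<close> is attached.\<close>

definition attach :: "'t pvt \<Rightarrow> 't anode \<Rightarrow> 't subst" where
  "attach P y = unif P y \<circ>\<^sub>s subst_of_ren (ren P y)"


section \<open>Substitution proof trees\<close>

type_synonym 't espt = "('t subst \<times> 't enode, 't subst \<times> 't anode) etree"
type_synonym 't aspt = "('t subst \<times> 't enode, 't subst \<times> 't anode) atree"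

definition app_spt :: "'t subst \<Rightarrow> 't espt \<Rightarrow> 't espt" where
  "app_spt \<delta> = map_etree (apfst ((\<circ>\<^sub>s) \<delta>)) (apfst ((\<circ>\<^sub>s) \<delta>))"

text \<open>\<open>espt G A s P x T\<close> and \<open>aspt G A s P y T\<close> mean that \<open>T\<close> belongs to the set of substitution
  proof trees of the e-node \<open>x\<close>, resp. of the a-node \<open>y\<close>.\<close>

inductive espt :: "('n, 't) grammar \<Rightarrow> 't assertion set \<Rightarrow> 't assertion \<Rightarrow> 't pvt \<Rightarrow>
                   't enode \<Rightarrow> 't espt \<Rightarrow> bool"
      and aspt :: "('n, 't) grammar \<Rightarrow> 't assertion set \<Rightarrow> 't assertion \<Rightarrow> 't pvt \<Rightarrow>
                   't anode \<Rightarrow> 't aspt \<Rightarrow> bool"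
  for G A s P where
  premise:
    "\<lbrakk>x \<in> enodes G A P; p \<in> set (premises_of s); is_subst G \<theta>;
      moved \<theta> \<subseteq> vars G (expr_of P x) - avars G s; app \<theta> (expr_of P x) = p\<rbrakk>
     \<Longrightarrow> espt G A s P x (ENode (\<theta>, x) None)"
| combine:
    "\<lbrakk>(x, a) \<in> anodes G A P; length Ts = length (premises_of a);
      \<forall>i < length (premises_of a). espt G A s P (x @ [(a, i)]) (Ts ! i);
      \<theta>s = map (\<lambda>T. fst (elabel T)) Ts; is_mgu G (avars G s) (set \<theta>s) \<delta>\<rbrakk>
     \<Longrightarrow> aspt G A s P (x, a) (ANode (com \<delta> \<theta>s, (x, a)) (map (app_spt \<delta>) Ts))"
| extend:
    "\<lbrakk>(x, a) \<in> anodes G A P; aspt G A s P (x, a) T\<rbrakk>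
     \<Longrightarrow> espt G A s P x (ENode (fst (alabel T), x) (Some T))"

definition proof_tree_of :: "'t pvt \<Rightarrow> 't espt \<Rightarrow> 't proof_tree" where
  "proof_tree_of P =
     map_etree (\<lambda>(\<theta>, x). app \<theta> (expr_of P x)) (\<lambda>(\<theta>, y). (snd y, \<theta> \<circ>\<^sub>s attach P y))"

end

theory Submission
  imports Defs
begin

text \<open>The labels of \<open>\<pi>(T)\<close> are obtained from the PVT by applying substitutions, so two things
  have to be checked: that every label is type-correct, and that every transition is an instance
  of its assertion.

  Type-correctness rests on the condition that a variable is only ever produced by the rule from
  its own type: replacing each derivation step that produces a variable by a derivation of the
  expression substituted for it shows that substitutions preserve types (\<open>has_type_app\<close>). Hence
  substitutions are closed under composition, and all expressions of the PVT belong to \<open>L(G)\<close>.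

  For the transitions, consider an a-node \<open>a\<close> with children \<open>e\<^sub>1, \<dots>, e\<^sub>m\<close>, attached to \<open>e\<^sub>0\<close> with
  \<open>\<eta>\<close>, the unifier preceded by the renaming of the variables of \<open>a\<close>. By construction of the PVT the \<open>e\<^sub>i\<close> and \<open>e\<^sub>0\<close> are the components of \<open>\<eta>(a)\<close>.
  The subtrees \<open>T\<^sub>i\<close> below it carry different substitutions \<open>\<theta>\<^sub>i\<close>, but \<open>\<delta>\<close> unifies them: all
  \<open>\<delta> \<circ> \<theta>\<^sub>i\<close> equal the one substitution \<open>\<theta>\<close> of the a-node. Therefore the transition reads
  \<open>\<theta>(e\<^sub>1), \<dots>, \<theta>(e\<^sub>m)\<close> to \<open>\<theta>(e\<^sub>0)\<close>, which is \<open>(\<theta> \<circ> \<eta>)(a)\<close> (\<open>is_proof_join\<close>). Replacing \<open>T\<^sub>i\<close> by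
  \<open>\<delta>(T\<^sub>i)\<close> does no harm deeper in the tree, because an instance of a proof is a proof
  (\<open>is_proof_inst\<close>). The theorem follows by induction on the generation of \<open>T\<close>.\<close>

section \<open>Substitutions preserve types\<close>

lemma app_subst_comp: "app (\<delta> \<circ>\<^sub>s \<theta>) e = app \<delta> (app \<theta> e)"
  by (induction e) (simp_all add: app_def subst_comp_def)

lemma subst_comp_assoc: "\<delta> \<circ>\<^sub>s (\<theta> \<circ>\<^sub>s \<eta>) = (\<delta> \<circ>\<^sub>s \<theta>) \<circ>\<^sub>s \<eta>"
  by (rule ext) (simp add: subst_comp_def app_subst_comp[unfolded subst_comp_def])

lemma app_assertion_comp: "app_assertion (\<delta> \<circ>\<^sub>s \<theta>) a = app_assertion \<delta> (app_assertion \<theta> a)"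
  by (simp add: app_assertion_def app_subst_comp)

lemma has_type_iff: "has_type G e n \<longleftrightarrow> derives G [NT n] (map TM e)"
proof -
  have "step (G\<lparr>start := n\<rparr>) = step G"
    by (intro ext) (simp add: step_def)
  then show ?thesis by (simp add: has_type_def lang_def derives_def)
qed

lemma lang_iff_has_type: "e \<in> lang G \<longleftrightarrow> has_type G e (start G)"
  by (simp add: has_type_iff lang_def)

lemma derives_trans: "derives G u v \<Longrightarrow> derives G v w \<Longrightarrow> derives G u w"
  by (simp add: derives_def)

lemma derives_rule: "(n, \<alpha>) \<in> rules G \<Longrightarrow> derives G [NT n] \<alpha>"
  unfolding derives_def by (rule r_into_rtranclp) (force simp: step_def)

lemma derives_in_context:
  assumes "derives G u w" shows "derives G (l @ u @ r) (l @ w @ r)"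
  using assms unfolding derives_def
proof (induction rule: rtranclp_induct)
  case (step v w)
  from step.hyps(2) obtain l' n r' \<alpha>
    where "v = l' @ [NT n] @ r'" "w = l' @ \<alpha> @ r'" "(n, \<alpha>) \<in> rules G"
    by (auto simp: step_def)
  then have "step G (l @ v @ r) (l @ w @ r)"
    unfolding step_def by (intro exI[of _ "l @ l'"] exI[of _ n] exI[of _ "r' @ r"] exI[of _ \<alpha>]) simp
  with step.IH show ?case by simp
qed simp

text \<open>Sentential forms mix terminals and non-terminals, so transporting a derivation along a
  substitution needs the extension that leaves the non-terminals alone.\<close>

definition app_form :: "'t subst \<Rightarrow> ('n, 't) symbol list \<Rightarrow> ('n, 't) symbol list" where
  "app_form \<theta> u = concat (map (case_symbol (\<lambda>n. [NT n]) (\<lambda>t. map TM (\<theta> t))) u)"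

lemma app_form_simps:
  "app_form \<theta> (u @ w) = app_form \<theta> u @ app_form \<theta> w"
  "app_form \<theta> [NT n] = [NT n]"
  "app_form \<theta> [TM t] = map TM (\<theta> t)"
  by (simp_all add: app_form_def)

lemma app_form_TM: "app_form \<theta> (map TM e) = map TM (app \<theta> e)"
  by (induction e) (simp_all add: app_form_def app_def)

lemma app_form_no_vars:
  assumes "is_subst G \<theta>" and "\<And>t. TM t \<in> set u \<Longrightarrow> vtype G t = None"
  shows "app_form \<theta> u = u"
  using assms(2)
proof (induction u)
  case (Cons y u)
  with assms(1) show ?case
    by (cases y) (simp_all add: app_form_def is_subst_def)
qed (simp add: app_form_def)

lemma subst_has_type_of_var:
  assumes "is_subst G \<theta>" and "vtype G v = Some n"
  shows "has_type G (\<theta> v) n"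
  using assms unfolding is_subst_def has_type_iff by (blast intro: derives_trans)

text \<open>A right-hand side with a variable in it is just that variable, and then the rule is
  replaced by a derivation of the expression substituted for it; any other right-hand side is
  left unchanged by the substitution.\<close>

lemma derives_app_form_rule:
  assumes G: "wf_grammar G" and \<theta>: "is_subst G \<theta>" and r: "(n, \<alpha>) \<in> rules G"
  shows "derives G [NT n] (app_form \<theta> \<alpha>)"
proof (cases "\<exists>v. TM v \<in> set \<alpha> \<and> vtype G v \<noteq> None")
  case True
  then obtain v where "\<alpha> = [TM v]" "vtype G v = Some n"
    using G r unfolding wf_grammar_def by blast
  then show ?thesis
    using subst_has_type_of_var[OF \<theta>] by (simp add: app_form_simps has_type_iff)
next
  case False
  then have "app_form \<theta> \<alpha> = \<alpha>" using app_form_no_vars[OF \<theta>] by blast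
  with derives_rule[OF r] show ?thesis by simp
qed

lemma derives_app_form:
  assumes G: "wf_grammar G" and \<theta>: "is_subst G \<theta>" and "derives G u w"
  shows "derives G (app_form \<theta> u) (app_form \<theta> w)"
  using assms(3) unfolding derives_def
proof (induction rule: rtranclp_induct)
  case (step v w)
  from step.hyps(2) obtain l n r \<alpha>
    where v: "v = l @ [NT n] @ r" and w: "w = l @ \<alpha> @ r" and r: "(n, \<alpha>) \<in> rules G"
    by (auto simp: step_def)
  have "derives G (app_form \<theta> v) (app_form \<theta> w)"
    using derives_in_context[OF derives_app_form_rule[OF G \<theta> r]]
    by (simp only: v w app_form_simps)
  with step.IH show ?case by (simp add: derives_def)
qed simp

lemma has_type_app:
  assumes "wf_grammar G" "is_subst G \<theta>" "has_type G e n"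
  shows "has_type G (app \<theta> e) n"
  using derives_app_form[OF assms(1,2), of "[NT n]" "map TM e"] assms(3)
  by (simp add: has_type_iff app_form_TM app_form_simps)

lemma app_in_lang: "wf_grammar G \<Longrightarrow> is_subst G \<theta> \<Longrightarrow> e \<in> lang G \<Longrightarrow> app \<theta> e \<in> lang G"
  by (simp add: lang_iff_has_type has_type_app)

lemma is_subst_comp:
  assumes G: "wf_grammar G" and \<delta>: "is_subst G \<delta>" and \<theta>: "is_subst G \<theta>"
  shows "is_subst G (\<delta> \<circ>\<^sub>s \<theta>)"
  unfolding is_subst_def
proof (intro conjI allI impI)
  fix c assume "vtype G c = None"
  with \<delta> \<theta> show "(\<delta> \<circ>\<^sub>s \<theta>) c = [c]" by (simp add: is_subst_def subst_comp_def app_def)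
next
  fix v n assume "vtype G v = Some n"
  with \<theta> obtain m where "derives G [NT n] [NT m]" "has_type G (\<theta> v) m"
    unfolding is_subst_def by blast
  then show "\<exists>m. derives G [NT n] [NT m] \<and> has_type G ((\<delta> \<circ>\<^sub>s \<theta>) v) m"
    using has_type_app[OF G \<delta>] unfolding subst_comp_def by blast
qed

lemma is_subst_renaming:
  assumes G: "wf_grammar G" and \<rho>: "is_renaming G (avars G a) \<rho>"
  shows "is_subst G (subst_of_ren \<rho>)"
  unfolding is_subst_def
proof (intro conjI allI impI)
  fix c assume "vtype G c = None"
  then have "c \<notin> avars G a" by (simp add: avars_def vars_def)
  with \<rho> show "subst_of_ren \<rho> c = [c]" by (simp add: is_renaming_def subst_of_ren_def)
next
  fix v n assume v: "vtype G v = Some n"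
  have "vtype G (\<rho> v) = vtype G v"
    using \<rho> unfolding is_renaming_def by (cases "v \<in> avars G a") auto
  with v have "vtype G (\<rho> v) = Some n" by simp
  then have "(n, [TM (\<rho> v)]) \<in> rules G" using G unfolding wf_grammar_def by blast
  then have "has_type G (subst_of_ren \<rho> v) n"
    by (simp add: has_type_iff subst_of_ren_def derives_rule)
  moreover have "derives G [NT n] [NT n]" by (simp add: derives_def)
  ultimately show "\<exists>m. derives G [NT n] [NT m] \<and> has_type G (subst_of_ren \<rho> v) m" by blast
qed


section \<open>The expressions of the proof variant tree\<close>

lemma anode_props:
  assumes P: "is_pvt G A s P" and y: "(x, a) \<in> anodes G A P"
  shows "x \<in> enodes G A P" and "a \<in> A"
    and "is_renaming G (avars G a) (ren P (x, a))" and "is_subst G (unif P (x, a))"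
    and "expr_of P x = app (unif P (x, a)) (proposition_of (renamed P (x, a)))"
    and "\<forall>i < length (premises_of a).
      expr_of P (x @ [(a, i)]) = app (unif P (x, a)) (premises_of (renamed P (x, a)) ! i)"
  using y bspec[OF P[unfolded is_pvt_def, THEN conjunct2] y, simplified prod.case]
  by (simp_all add: anodes_def)

lemma is_subst_attach:
  assumes "wf_grammar G" "is_pvt G A s P" "(x, a) \<in> anodes G A P"
  shows "is_subst G (attach P (x, a))"
  unfolding attach_def
  using is_subst_comp[OF assms(1)] is_subst_renaming[OF assms(1)] anode_props(3,4)[OF assms(2,3)]
  by blast

lemma app_attach:
  assumes P: "is_pvt G A s P" and y: "(x, a) \<in> anodes G A P"
  shows app_attach_proposition: "expr_of P x = app (attach P (x, a)) (proposition_of a)"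
    and app_attach_premise: "i < length (premises_of a) \<Longrightarrow>
      expr_of P (x @ [(a, i)]) = app (attach P (x, a)) (premises_of a ! i)"
proof -
  have "expr_of P x = app (unif P (x, a)) (proposition_of (renamed P (x, a)))"
    by (rule anode_props(5)[OF P y])
  then show "expr_of P x = app (attach P (x, a)) (proposition_of a)"
    by (simp add: renamed_def app_assertion_def attach_def app_subst_comp)
next
  assume i: "i < length (premises_of a)"
  then have "expr_of P (x @ [(a, i)]) = app (unif P (x, a)) (premises_of (renamed P (x, a)) ! i)"
    using anode_props(6)[OF P y] by blast
  with i show "expr_of P (x @ [(a, i)]) = app (attach P (x, a)) (premises_of a ! i)"
    by (simp add: renamed_def app_assertion_def attach_def app_subst_comp)
qed

lemma expr_of_in_lang:
  assumes D: "deductive_system G A" and s: "wf_assertion G s" and P: "is_pvt G A s P"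
    and "x \<in> enodes G A P"
  shows "expr_of P x \<in> lang G"
  using assms(4)
proof (induction rule: enodes.induct)
  case 1
  from P s show ?case by (simp add: is_pvt_def wf_assertion_def)
next
  case (2 x a i)
  then have y: "(x, a) \<in> anodes G A P" by (simp add: anodes_def)
  have "premises_of a ! i \<in> lang G"
    using D 2 unfolding deductive_system_def wf_assertion_def by (meson nth_mem subsetD)
  then show ?case
    using app_in_lang[OF _ is_subst_attach[OF _ P y]] D app_attach_premise[OF P y] 2
    by (simp add: deductive_system_def)
qed


section \<open>Instances and composition of proofs\<close>

lemma is_proof_ENode:
  "is_proof G A (ENode e None) \<longleftrightarrow> e \<in> lang G"
  "is_proof G A (ENode e (Some (ANode (a, \<theta>) ts))) \<longleftrightarrow>
     e \<in> lang G \<and> a \<in> A \<and> is_subst G \<theta> \<and> (ts = [] \<longrightarrow> premises_of a = []) \<and>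
     Assertion (map elabel ts) e = app_assertion \<theta> a \<and> (\<forall>t\<in>set ts. is_proof G A t)"
  unfolding is_proof_def by auto

definition inst :: "'t subst \<Rightarrow> 't proof_tree \<Rightarrow> 't proof_tree" where
  "inst \<delta> = map_etree (app \<delta>) (\<lambda>(a, \<theta>). (a, \<delta> \<circ>\<^sub>s \<theta>))"

lemma elabel_inst: "elabel (inst \<delta> t) = app \<delta> (elabel t)"
  by (cases t) (simp add: inst_def)

lemma is_proof_inst:
  assumes "wf_grammar G" and "is_subst G \<delta>" and "is_proof G A t"
  shows "is_proof G A (inst \<delta> t)"
  using assms
proof (induction G A t rule: is_proof_tree.induct)
  case (1 G A e)
  then show ?case by (simp add: inst_def is_proof_ENode app_in_lang)
next
  case (2 G A e a \<theta> ts)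
  then have e: "Assertion (map elabel ts) e = app_assertion \<theta> a" by (simp add: is_proof_ENode)
  have "Assertion (map (app \<delta>) (map elabel ts)) (app \<delta> e) = app_assertion (\<delta> \<circ>\<^sub>s \<theta>) a"
    by (simp only: app_assertion_comp flip: e) (simp add: app_assertion_def)
  then have "Assertion (map elabel (map (inst \<delta>) ts)) (app \<delta> e) = app_assertion (\<delta> \<circ>\<^sub>s \<theta>) a"
    by (simp add: elabel_inst comp_def)
  moreover have "inst \<delta> (ENode e (Some (ANode (a, \<theta>) ts))) =
      ENode (app \<delta> e) (Some (ANode (a, \<delta> \<circ>\<^sub>s \<theta>) (map (inst \<delta>) ts)))"
    by (simp add: inst_def)
  ultimately show ?case
    using 2 by (auto simp: is_proof_ENode intro: app_in_lang is_subst_comp)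
qed

text \<open>Applying \<open>\<delta>\<close> to the labels of an SPT commutes with \<open>\<pi>\<close>, which turns the subtrees
  \<open>\<delta>(T\<^sub>i)\<close> of a combined SPT into instances of proofs.\<close>

lemma proof_tree_of_app_spt: "proof_tree_of P (app_spt \<delta> T) = inst \<delta> (proof_tree_of P T)"
  unfolding proof_tree_of_def app_spt_def inst_def etree.map_comp
  by (intro etree.map_cong refl)
     (auto simp: app_subst_comp subst_comp_assoc split: prod.splits)

lemma elabel_proof_tree_of:
  "elabel (proof_tree_of P T) = app (fst (elabel T)) (expr_of P (snd (elabel T)))"
  by (cases T) (auto simp: proof_tree_of_def split: prod.splits)

lemma com_eq:
  assumes "is_unifier G F (set \<theta>s) \<delta>" and "\<theta> \<in> set \<theta>s"
  shows "com \<delta> \<theta>s = \<delta> \<circ>\<^sub>s \<theta>"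
  using assms by (cases \<theta>s) (auto simp: is_unifier_def)

lemma is_subst_com:
  assumes "wf_grammar G" "is_subst G \<delta>" "\<forall>\<theta>\<in>set \<theta>s. is_subst G \<theta>"
  shows "is_subst G (com \<delta> \<theta>s)"
  using assms by (cases \<theta>s) (auto intro: is_subst_comp)

text \<open>The soundness step: proofs of the instances \<open>\<theta>\<^sub>i(e\<^sub>i)\<close> join, after unification of the
  \<open>\<theta>\<^sub>i\<close>, to a proof of the common instance of the parent.\<close>

lemma is_proof_join:
  assumes D: "deductive_system G A" and s: "wf_assertion G s" and P: "is_pvt G A s P"
    and y: "(x, a) \<in> anodes G A P" and len: "length Ts = length (premises_of a)"
    and loc: "\<And>i. i < length Ts \<Longrightarrow> snd (elabel (Ts ! i)) = x @ [(a, i)]"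
    and sub: "\<And>T. T \<in> set Ts \<Longrightarrow> is_subst G (fst (elabel T))"
    and pf: "\<And>T. T \<in> set Ts \<Longrightarrow> is_proof G A (proof_tree_of P T)"
    and \<theta>s: "\<theta>s = map (\<lambda>T. fst (elabel T)) Ts"
    and un: "is_unifier G F (set \<theta>s) \<delta>"
  shows "is_proof G A (proof_tree_of P
    (ENode (com \<delta> \<theta>s, x) (Some (ANode (com \<delta> \<theta>s, (x, a)) (map (app_spt \<delta>) Ts)))))"
proof -
  define \<theta> where "\<theta> = com \<delta> \<theta>s"
  define ts where "ts = map (\<lambda>T. inst \<delta> (proof_tree_of P T)) Ts"
  have G: "wf_grammar G" using D by (simp add: deductive_system_def)
  have \<delta>: "is_subst G \<delta>" using un by (simp add: is_unifier_def)
  have \<theta>: "is_subst G \<theta>"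
    unfolding \<theta>_def using is_subst_com[OF G \<delta>] sub \<theta>s by auto
  have lab: "elabel (ts ! i) = app \<theta> (expr_of P (x @ [(a, i)]))" if i: "i < length Ts" for i
  proof -
    have "fst (elabel (Ts ! i)) \<in> set \<theta>s" using i by (simp add: \<theta>s)
    from com_eq[OF un this] show ?thesis
      using i by (simp add: ts_def elabel_inst elabel_proof_tree_of loc \<theta>_def app_subst_comp)
  qed
  have "map elabel ts = map (app (\<theta> \<circ>\<^sub>s attach P (x, a))) (premises_of a)"
    using len lab app_attach_premise[OF P y]
    by (intro nth_equalityI) (simp_all add: ts_def app_subst_comp)
  then have trans:
    "Assertion (map elabel ts) (app \<theta> (expr_of P x)) = app_assertion (\<theta> \<circ>\<^sub>s attach P (x, a)) a"
    by (simp add: app_assertion_def app_attach_proposition[OF P y] app_subst_comp)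
  have "proof_tree_of P (ENode (\<theta>, x) (Some (ANode (\<theta>, (x, a)) (map (app_spt \<delta>) Ts)))) =
      ENode (app \<theta> (expr_of P x)) (Some (ANode (a, \<theta> \<circ>\<^sub>s attach P (x, a)) ts))"
    by (simp add: ts_def flip: proof_tree_of_app_spt) (simp add: proof_tree_of_def)
  moreover have "app \<theta> (expr_of P x) \<in> lang G"
    using app_in_lang[OF G \<theta>] expr_of_in_lang[OF D s P] anode_props(1)[OF P y] by blast
  moreover have "is_subst G (\<theta> \<circ>\<^sub>s attach P (x, a))"
    using is_subst_comp[OF G \<theta>] is_subst_attach[OF G P y] by blast
  moreover have "ts = [] \<longrightarrow> premises_of a = []" using len by (auto simp: ts_def)
  moreover have "\<forall>t\<in>set ts. is_proof G A t"
    using is_proof_inst[OF G \<delta>] pf by (auto simp: ts_def)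
  ultimately show ?thesis
    using trans anode_props(2)[OF P y] by (simp add: is_proof_ENode flip: \<theta>_def)
qed

text \<open>An SPT of an a-node has no expression at its root, hence no image under \<open>\<pi>\<close>; the induction
  speaks instead of the SPT obtained by extending it to the parent e-node, since that is what
  becomes of it next.\<close>

lemma spt_sound:
  assumes D: "deductive_system G A" and s: "wf_assertion G s" and P: "is_pvt G A s P"
  shows "espt G A s P x T \<Longrightarrow>
      snd (elabel T) = x \<and> is_subst G (fst (elabel T)) \<and> is_proof G A (proof_tree_of P T)"
    and "aspt G A s P y U \<Longrightarrow>
      is_subst G (fst (alabel U)) \<and>
      is_proof G A (proof_tree_of P (ENode (fst (alabel U), fst y) (Some U)))"
proof (induction rule: espt_aspt.inducts)
  case (premise x p \<theta>)
  then have "p \<in> lang G" using s unfolding wf_assertion_def by blast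
  with premise show ?case by (simp add: proof_tree_of_def is_proof_ENode)
next
  case (combine x a Ts \<theta>s \<delta>)
  have G: "wf_grammar G" using D by (simp add: deductive_system_def)
  have y: "(x, a) \<in> anodes G A P" and len: "length Ts = length (premises_of a)"
    and \<theta>s: "\<theta>s = map (\<lambda>T. fst (elabel T)) Ts"
    using combine by blast+
  have un: "is_unifier G (avars G s) (set \<theta>s) \<delta>" using combine by (simp add: is_mgu_def)
  then have \<delta>: "is_subst G \<delta>" by (simp add: is_unifier_def)
  have loc: "snd (elabel (Ts ! i)) = x @ [(a, i)]" if "i < length Ts" for i
    using combine that by simp
  have sub: "is_subst G (fst (elabel T))" and pf: "is_proof G A (proof_tree_of P T)"
    if "T \<in> set Ts" for T
    using combine that by (metis in_set_conv_nth)+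
  have "is_subst G (com \<delta> \<theta>s)"
    using is_subst_com[OF G \<delta>] sub \<theta>s by auto
  with is_proof_join[OF D s P y len loc sub pf \<theta>s un] show ?case by simp
next
  case (extend x a T)
  then show ?case by simp
qed

theorem theorem1:
  fixes G :: "('n, 't) grammar" and A :: "'t assertion set" and s :: "'t assertion"
    and P :: "'t pvt" and x :: "'t enode" and \<theta> :: "'t subst" and T :: "'t espt"
  assumes "deductive_system G A"
    and "wf_assertion G s"
    and "is_pvt G A s P"
    and "espt G A s P x T"
    and "elabel T = (\<theta>, x)"
  shows "is_proof G A (proof_tree_of P T) \<and>
         elabel (proof_tree_of P T) = app \<theta> (expr_of P x)"
  using spt_sound(1)[OF assms(1-4)] assms(5) by (simp add: elabel_proof_tree_of)

end
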